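(* Let $(X,\sigma)$ be an infinite minimal one-sided Sturmian shift and let $(\bar X,\bar\sigma)$ be its two-sided version. Then both $\mathrm{Aut}(X,\sigma)$ and $\mathrm{Aut}(\bar X,\bar\sigma)/\{\bar\sigma^n : n\in\mathbb Z\}$ are trivial, i.e. consist of only the identity.
   Context: Let $\mathcal A$ be a finite alphabet with the discrete topology and $\mathbb N_0=\{0,1,2,\dots\}$. A one-sided shift $(X,\sigma)$ is a closed shift-invariant subset $X\subseteq\mathcal A^{\mathbb N_0}$ (product topology) with the left shift $\sigma$; a two-sided shift is a closed shift-invariant subset of $\mathcal A^{\mathbb Z}$ with the left shift $\bar\sigma$. Minimal means that every orbit (forward orbit in the one-sided case) is dense. The language $\mathcal L_X$ is the set of all finite words occurring in points of $X$, and the complexity $p(n)$ is the number of words of length $n$ in $\mathcal L_X$. An infinite minimal Sturmian shift is an infinite minimal shift whose complexity function is $p(n)=n+1$ for all $n\ge 1$. The two-sided version $(\bar X,\bar\sigma)$ of a one-sided minimal shift $(X,\sigma)$ is the set $\bar X$ of all bi-infinite sequences all of whose finite words lie in $\mathcal L_X$, with the shift $\bar\sigma$. An automorphism of a (one- or two-sided) shift is a continuous bijection of the space onto itself commuting with the shift map; $\mathrm{Aut}$ denotes the group of automorphisms. In the two-sided case, $\{\bar\sigma^n:n\in\mathbb Z\}$ is a normal subgroup of $\mathrm{Aut}(\bar X,\bar\sigma)$. *)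

theory Defs
  imports "HOL-Analysis.Analysis" "HOL-Algebra.Bij" "HOL-Algebra.Elementary_Groups"
begin

section \<open>Shift spaces\<close>

text \<open>One-sided and two-sided sequences are treated together: the index type is
  \<^typ>\<open>nat\<close> for one-sided and \<^typ>\<open>int\<close> for two-sided sequences.\<close>

definition shift :: "('i::semiring_1 \<Rightarrow> 'a) \<Rightarrow> 'i \<Rightarrow> 'a"
  where "shift x = (\<lambda>i. x (i + 1))"

definition full_shift :: "'a set \<Rightarrow> ('i::semiring_1 \<Rightarrow> 'a) topology"
  where "full_shift A = product_topology (\<lambda>_. discrete_topology A) UNIV"

definition subshift :: "'a set \<Rightarrow> ('i::semiring_1 \<Rightarrow> 'a) set \<Rightarrow> bool"
  where "subshift A X \<longleftrightarrow> closedin (full_shift A) X \<and> shift ` X \<subseteq> X"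

abbreviation subshift_topology :: "'a set \<Rightarrow> ('i::semiring_1 \<Rightarrow> 'a) set \<Rightarrow> ('i \<Rightarrow> 'a) topology"
  where "subshift_topology A X \<equiv> subtopology (full_shift A) X"

definition minimal_one_sided :: "'a set \<Rightarrow> (nat \<Rightarrow> 'a) set \<Rightarrow> bool"
  where "minimal_one_sided A X \<longleftrightarrow>
    (\<forall>x\<in>X. subshift_topology A X closure_of (range (\<lambda>n. (shift ^^ n) x)) = X)"

definition word_at :: "('i::semiring_1 \<Rightarrow> 'a) \<Rightarrow> 'i \<Rightarrow> nat \<Rightarrow> 'a list"
  where "word_at x i n = map (\<lambda>k. x (i + of_nat k)) [0..<n]"

definition language :: "('i::semiring_1 \<Rightarrow> 'a) set \<Rightarrow> 'a list set"
  where "language X = {word_at x i n | x i n. x \<in> X}"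

definition complexity :: "('i::semiring_1 \<Rightarrow> 'a) set \<Rightarrow> nat \<Rightarrow> nat"
  where "complexity X n = card {w \<in> language X. length w = n}"

definition sturmian_one_sided :: "'a set \<Rightarrow> (nat \<Rightarrow> 'a) set \<Rightarrow> bool"
  where "sturmian_one_sided A X \<longleftrightarrow>
    subshift A X \<and> infinite X \<and> minimal_one_sided A X \<and> (\<forall>n\<ge>1. complexity X n = n + 1)"

definition two_sided_version :: "(nat \<Rightarrow> 'a) set \<Rightarrow> (int \<Rightarrow> 'a) set"
  where "two_sided_version X = {y. \<forall>i n. word_at y i n \<in> language X}"

section \<open>Automorphism groups\<close>

text \<open>Automorphisms are represented by functions that are extensional on \<open>X\<close>, as in
  \<^const>\<open>BijGroup\<close>, so that equality in the group is equality on \<open>X\<close>.\<close>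

definition Aut_shift ::
    "'a set \<Rightarrow> ('i::semiring_1 \<Rightarrow> 'a) set \<Rightarrow> (('i \<Rightarrow> 'a) \<Rightarrow> ('i \<Rightarrow> 'a)) monoid"
  where "Aut_shift A X = (BijGroup X)
    \<lparr>carrier := {f \<in> Bij X. continuous_map (subshift_topology A X) (subshift_topology A X) f
                          \<and> (\<forall>x\<in>X. f (shift x) = shift (f x))}\<rparr>"

definition shift_powers :: "'a set \<Rightarrow> (int \<Rightarrow> 'a) set \<Rightarrow> ((int \<Rightarrow> 'a) \<Rightarrow> (int \<Rightarrow> 'a)) set"
  where "shift_powers A X = range (\<lambda>n::int. restrict shift X [^]\<^bsub>Aut_shift A X\<^esub> n)"

section \<open>Well-definedness of the groups\<close>

lemma topspace_full_shift: "topspace (full_shift A) = {x. range x \<subseteq> A}"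
  by (auto simp: full_shift_def PiE_def Pi_def extensional_def)

lemma openin_full_shift_cylinder:
  fixes y :: "'i::semiring_1 \<Rightarrow> 'a"
  assumes "finite F" "range y \<subseteq> A"
  shows "openin (full_shift A) {z. range z \<subseteq> A \<and> (\<forall>j\<in>F. z j = y j)}"
proof -
  have "openin (full_shift A) (\<Pi>\<^sub>E j\<in>(UNIV::'i set). if j \<in> F then {y j} else A)"
    unfolding full_shift_def
  proof (rule product_topology_basis)
    show "openin (discrete_topology A) (if j \<in> F then {y j} else A)" for j
      using assms(2) by auto
    have "{j. (if j \<in> F then {y j} else A) \<noteq> topspace (discrete_topology A)} \<subseteq> F"
      by auto
    then show "finite {j. (if j \<in> F then {y j} else A) \<noteq> topspace (discrete_topology A)}"
      using assms(1) finite_subset by blast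
  qed
  moreover have "(\<Pi>\<^sub>E j\<in>(UNIV::'i set). if j \<in> F then {y j} else A)
      = {z. range z \<subseteq> A \<and> (\<forall>j\<in>F. z j = y j)}"
    using assms(2) by (auto simp: PiE_def Pi_def extensional_def split: if_splits)
  ultimately show ?thesis by simp
qed

lemma continuous_map_shift: "continuous_map (full_shift A) (full_shift A) shift"
  unfolding full_shift_def shift_def
  by (subst continuous_map_componentwise_UNIV)
     (auto intro!: continuous_map_product_projection)

lemma
  assumes "finite A" "subshift A X"
  shows compact_space_subshift: "compact_space (subshift_topology A X)"
    and Hausdorff_space_subshift: "Hausdorff_space (subshift_topology A X)"
    and topspace_subshift: "topspace (subshift_topology A X) = X"
proof -
  have "compact_space (full_shift A :: ('b \<Rightarrow> 'a) topology)"
    using assms(1)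
    by (auto simp: full_shift_def compact_space_product_topology compact_space_discrete_topology)
  then show "compact_space (subshift_topology A X)"
    using assms(2) by (simp add: closedin_compact_space compact_space_subtopology subshift_def)
  show "Hausdorff_space (subshift_topology A X)"
    by (simp add: full_shift_def Hausdorff_space_subtopology Hausdorff_space_product_topology)
  show "topspace (subshift_topology A X) = X"
    using assms(2) by (auto simp: subshift_def dest: closedin_subset)
qed

lemma group_Aut_shift:
  assumes "finite A" "subshift A X"
  shows "group (Aut_shift A X)"
proof -
  let ?T = "subshift_topology A X"
  define C where "C = {f \<in> Bij X. continuous_map ?T ?T f \<and> (\<forall>x\<in>X. f (shift x) = shift (f x))}"
  note top = topspace_subshift[OF assms]
  have sX: "shift x \<in> X" if "x \<in> X" for x
    using assms(2) that by (auto simp: subshift_def)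
  interpret B: group "BijGroup X" by (rule group_BijGroup)
  have "subgroup C (BijGroup X)"
  proof (rule B.subgroupI)
    show "C \<subseteq> carrier (BijGroup X)" by (auto simp: C_def BijGroup_def)
    have "(\<lambda>x\<in>X. x) \<in> C"
      using sX by (auto simp: C_def id_Bij top intro: continuous_map_eq[OF continuous_map_id])
    then show "C \<noteq> {}" by blast
  next
    fix f assume f: "f \<in> C"
    then have fB: "f \<in> Bij X" and fc: "continuous_map ?T ?T f"
      and fs: "\<And>x. x \<in> X \<Longrightarrow> f (shift x) = shift (f x)" by (auto simp: C_def)
    have bij: "bij_betw f X X" using fB by (simp add: Bij_def)
    have inv: "inv\<^bsub>BijGroup X\<^esub> f = (\<lambda>x\<in>X. inv_into X f x)"
      using fB by (rule inv_BijGroup)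
    let ?g = "\<lambda>x\<in>X. inv_into X f x"
    have "homeomorphic_map ?T ?T f"
      using bij fc top compact_space_subshift[OF assms] Hausdorff_space_subshift[OF assms]
      by (intro continuous_imp_homeomorphic_map) (auto simp: bij_betw_def)
    then obtain g where g: "homeomorphic_maps ?T ?T f g"
      by (auto simp: homeomorphic_map_maps)
    have "g x = ?g x" if "x \<in> X" for x
    proof -
      have "f (g x) = x" "g x \<in> X"
        using g that top by (auto simp: homeomorphic_maps_def continuous_map_def Pi_iff)
      then show ?thesis using that bij
        by (metis bij_betw_imp_inj_on inv_into_f_f restrict_apply')
    qed
    moreover have "continuous_map ?T ?T g"
      using g by (simp add: homeomorphic_maps_def)
    ultimately have gc: "continuous_map ?T ?T ?g"
      using top continuous_map_eq[of ?T ?T g ?g] by blast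
    have "?g (shift x) = shift (?g x)" if "x \<in> X" for x
    proof -
      define y where "y = inv_into X f x"
      have y: "y \<in> X" "f y = x"
        using bij that by (auto simp: y_def bij_betw_def inv_into_into f_inv_into_f)
      then have "inv_into X f (shift x) = shift y"
        using fs[OF y(1)] sX[OF y(1)] bij by (metis bij_betw_imp_inj_on inv_into_f_f)
      then show ?thesis using that sX by (simp add: y_def)
    qed
    then show "inv\<^bsub>BijGroup X\<^esub> f \<in> C"
      using gc fB unfolding inv by (simp add: C_def restrict_inv_into_Bij)
  next
    fix f g assume fg: "f \<in> C" "g \<in> C"
    then have B: "f \<in> Bij X" "g \<in> Bij X" by (auto simp: C_def)
    have "continuous_map ?T ?T (f \<circ> g)"
      using fg by (auto simp: C_def intro: continuous_map_compose)
    then have "continuous_map ?T ?T (compose X f g)"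
      by (rule continuous_map_eq) (auto simp: top compose_def)
    moreover have "g x \<in> X" if "x \<in> X" for x
      using B that by (auto dest: Bij_imp_funcset)
    moreover have "f (shift x) = shift (f x)" "g (shift x) = shift (g x)" if "x \<in> X" for x
      using fg that by (auto simp: C_def)
    ultimately have "compose X f g \<in> C"
      using B sX by (simp add: C_def compose_Bij compose_eq)
    then show "f \<otimes>\<^bsub>BijGroup X\<^esub> g \<in> C"
      using B by (simp add: BijGroup_def)
  qed
  then have "group ((BijGroup X)\<lparr>carrier := C\<rparr>)"
    using B.subgroup_imp_group by blast
  then show ?thesis by (simp add: Aut_shift_def C_def)
qed

lemma shift_image_two_sided_version: "shift ` two_sided_version X = two_sided_version X"
proof -
  have "shift y \<in> two_sided_version X" "(\<lambda>i. y (i - 1)) \<in> two_sided_version X"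
    if "y \<in> two_sided_version X" for y :: "int \<Rightarrow> 'a"
  proof -
    have "word_at (shift y) i n = word_at y (i + 1) n"
         "word_at (\<lambda>i. y (i - 1)) i n = word_at y (i - 1) n" for i n
      by (auto simp: word_at_def shift_def algebra_simps)
    then show "shift y \<in> two_sided_version X" "(\<lambda>i. y (i - 1)) \<in> two_sided_version X"
      using that by (auto simp: two_sided_version_def)
  qed
  moreover have "shift (\<lambda>i. y (i - 1)) = y" for y :: "int \<Rightarrow> 'a"
    by (simp add: shift_def)
  ultimately show ?thesis by (metis image_eqI image_subsetI subsetI subset_antisym)
qed

lemma range_two_sided_version:
  assumes "subshift A X" "y \<in> two_sided_version X"
  shows "range y \<subseteq> A"
proof
  fix a assume "a \<in> range y"
  then obtain i where a: "a = y i" by blast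
  have "word_at y i 1 \<in> language X"
    using assms(2) by (simp add: two_sided_version_def)
  then obtain x j n where x: "x \<in> X" "word_at y i 1 = word_at x j n"
    by (auto simp: language_def)
  from arg_cong[OF x(2), of length] have "n = 1" by (simp add: word_at_def)
  with x have "a = x j" by (simp add: word_at_def a)
  moreover have "range x \<subseteq> A"
    using assms(1) x(1) closedin_subset[of "full_shift A" X]
    by (auto simp: subshift_def topspace_full_shift)
  ultimately show "a \<in> A" by auto
qed

lemma subshift_two_sided_version:
  assumes "subshift A X"
  shows "subshift A (two_sided_version X)"
proof -
  let ?Y = "two_sided_version X"
  have sub: "?Y \<subseteq> topspace (full_shift A)"
    using range_two_sided_version[OF assms] by (auto simp: topspace_full_shift)
  have "full_shift A closure_of ?Y \<subseteq> ?Y"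
  proof
    fix y assume y: "y \<in> full_shift A closure_of ?Y"
    then have ry: "range y \<subseteq> A"
      by (auto simp: in_closure_of topspace_full_shift)
    have "word_at y i n \<in> language X" for i n
    proof -
      let ?F = "(\<lambda>k. i + int k) ` {..<n}"
      let ?U = "{z. range z \<subseteq> A \<and> (\<forall>j\<in>?F. z j = y j)}"
      have U: "openin (full_shift A) ?U"
        using ry by (intro openin_full_shift_cylinder) auto
      have yU: "y \<in> ?U" using ry by simp
      have "y \<in> T \<and> openin (full_shift A) T \<longrightarrow> (\<exists>z. z \<in> ?Y \<and> z \<in> T)" for T
        using y unfolding in_closure_of by (elim conjE allE)
      from mp[OF this conjI[OF yU U]] have "\<exists>z. z \<in> ?Y \<and> z \<in> ?U" .
      then obtain z where z: "z \<in> ?Y" "\<forall>j\<in>?F. z j = y j"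
        by blast
      have "word_at z i n = word_at y i n" using z(2) by (auto simp: word_at_def)
      moreover have "word_at z i n \<in> language X"
        using z(1) by (simp add: two_sided_version_def)
      ultimately show ?thesis by simp
    qed
    then show "y \<in> ?Y" by (simp add: two_sided_version_def)
  qed
  then have "closedin (full_shift A) ?Y"
    using sub closure_of_subset_eq by blast
  then show ?thesis
    by (simp add: subshift_def shift_image_two_sided_version)
qed

lemma shift_in_Aut_shift:
  fixes Y :: "(int \<Rightarrow> 'a) set"
  assumes "finite A" "subshift A Y" "shift ` Y = Y"
  shows "restrict shift Y \<in> carrier (Aut_shift A Y)"
proof -
  have inj: "inj (shift :: (int \<Rightarrow> 'a) \<Rightarrow> _)"
  proof (rule injI)
    fix x y :: "int \<Rightarrow> 'a" assume "shift x = shift y"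
    then have "x (i - 1 + 1) = y (i - 1 + 1)" for i unfolding shift_def by meson
    then show "x = y" by auto
  qed
  have "bij_betw shift Y Y"
    using assms(3) inj by (auto simp: bij_betw_def intro: inj_on_subset)
  then have "restrict shift Y \<in> Bij Y"
    by (simp add: Bij_def bij_betw_restrict_eq)
  moreover have "continuous_map (subshift_topology A Y) (subshift_topology A Y) shift"
    using assms(3) continuous_map_from_subtopology[OF continuous_map_shift]
    by (auto simp: continuous_map_in_subtopology)
  then have "continuous_map (subshift_topology A Y) (subshift_topology A Y) (restrict shift Y)"
    by (rule continuous_map_eq) (simp add: topspace_subshift[OF assms(1,2)])
  moreover have "shift x \<in> Y" if "x \<in> Y" for x using assms(3) that by blast
  ultimately show ?thesis by (auto simp: Aut_shift_def)
qed

lemma normal_shift_powers: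
  assumes "finite A" "subshift A X"
  shows "shift_powers A (two_sided_version X) \<lhd> Aut_shift A (two_sided_version X)"
proof -
  define Y where "Y = two_sided_version X"
  define s where "s = restrict shift Y"
  have Y: "subshift A Y" "shift ` Y = Y"
    unfolding Y_def by (rule subshift_two_sided_version[OF assms(2)] shift_image_two_sided_version)+
  interpret G: group "Aut_shift A Y" by (rule group_Aut_shift[OF assms(1) Y(1)])
  have s: "s \<in> carrier (Aut_shift A Y)"
    unfolding s_def by (rule shift_in_Aut_shift[OF assms(1) Y])
  have comm: "f \<otimes>\<^bsub>Aut_shift A Y\<^esub> s = s \<otimes>\<^bsub>Aut_shift A Y\<^esub> f" if f: "f \<in> carrier (Aut_shift A Y)" for f
  proof -
    have B: "f \<in> Bij Y" "s \<in> Bij Y" using f s by (auto simp: Aut_shift_def)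
    then have "f x \<in> Y" if "x \<in> Y" for x using that by (auto dest: Bij_imp_funcset)
    then show ?thesis using f B
      by (auto simp: Aut_shift_def BijGroup_def compose_def s_def fun_eq_iff)
  qed
  have eq: "shift_powers A Y = generate (Aut_shift A Y) {s}"
    using G.generate_pow[OF s] by (auto simp: shift_powers_def s_def)
  have sub: "subgroup (shift_powers A Y) (Aut_shift A Y)"
    unfolding eq using s by (intro G.generate_is_subgroup) auto
  have "f \<otimes>\<^bsub>Aut_shift A Y\<^esub> h \<otimes>\<^bsub>Aut_shift A Y\<^esub> inv\<^bsub>Aut_shift A Y\<^esub> f \<in> shift_powers A Y"
    if f: "f \<in> carrier (Aut_shift A Y)" and h: "h \<in> shift_powers A Y" for f h
  proof -
    obtain n :: int where n: "h = s [^]\<^bsub>Aut_shift A Y\<^esub> n"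
      using h by (auto simp: shift_powers_def s_def)
    have pow: "f \<otimes>\<^bsub>Aut_shift A Y\<^esub> (s [^]\<^bsub>Aut_shift A Y\<^esub> m) =
        (s [^]\<^bsub>Aut_shift A Y\<^esub> m) \<otimes>\<^bsub>Aut_shift A Y\<^esub> f" for m :: nat
      using G.group_commutes_pow[OF comm[OF f, symmetric] s f] by simp
    have "f \<otimes>\<^bsub>Aut_shift A Y\<^esub> h = h \<otimes>\<^bsub>Aut_shift A Y\<^esub> f"
    proof (cases "n \<ge> 0")
      case True
      then have "h = s [^]\<^bsub>Aut_shift A Y\<^esub> nat n"
        unfolding n by (simp add: pow_nat)
      then show ?thesis using pow[of "nat n"] by (simp only:)
    next
      case False
      define p where "p = s [^]\<^bsub>Aut_shift A Y\<^esub> nat (- n)"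
      have p: "p \<in> carrier (Aut_shift A Y)" "h = inv\<^bsub>Aut_shift A Y\<^esub> p"
        using False s n int_pow_def2[of "Aut_shift A Y" s n] by (auto simp: p_def simp del: pow_nat)
      have "f \<otimes>\<^bsub>Aut_shift A Y\<^esub> p = p \<otimes>\<^bsub>Aut_shift A Y\<^esub> f"
        unfolding p_def by (rule pow)
      then have "p \<otimes>\<^bsub>Aut_shift A Y\<^esub> (f \<otimes>\<^bsub>Aut_shift A Y\<^esub> inv\<^bsub>Aut_shift A Y\<^esub> p) =
          f \<otimes>\<^bsub>Aut_shift A Y\<^esub> p \<otimes>\<^bsub>Aut_shift A Y\<^esub> inv\<^bsub>Aut_shift A Y\<^esub> p"
        using p(1) f by (simp add: G.m_assoc)
      also have "\<dots> = f"
        using p(1) f by (simp add: G.m_assoc)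
      finally show ?thesis using p f by (simp add: G.inv_solve_left)
    qed
    then have "f \<otimes>\<^bsub>Aut_shift A Y\<^esub> h \<otimes>\<^bsub>Aut_shift A Y\<^esub> inv\<^bsub>Aut_shift A Y\<^esub> f = h"
      using f n s by (simp add: G.inv_solve_right')
    then show ?thesis using h by simp
  qed
  then show ?thesis
    using sub unfolding Y_def[symmetric] by (simp add: G.normal_inv_iff)
qed

end

theory Submission
  imports Defs
begin

text \<open>
  Since \<open>p(n + 1) - p(n) = 1\<close>, there is exactly one left special word of each length, and these
  words are the prefixes of a single point \<open>z\<close>, the only point of \<open>X\<close> with two shift preimages.
  A one-sided automorphism permutes the points with two preimages, so it fixes \<open>z\<close> and hence, by
  density, everything. In the two-sided shift, let \<open>a \<noteq> b\<close> have different entries at \<open>0\<close> and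
  both continue as \<open>z\<close> to the right. The images \<open>f a \<noteq> f b\<close> agree far to the right; if \<open>m\<close> is the
  last place where they differ, then \<open>f a\<close> also continues as \<open>z\<close> after \<open>m\<close>. Thus \<open>f\<close> acts as the
  translation by \<open>-m\<close> on the right half of \<open>a\<close>, and as \<open>f\<close> is a block code and every word
  occurs in \<open>z\<close>, it is that translation everywhere.
\<close>

section \<open>Words and languages\<close>

lemma funpow_shift: "(shift ^^ k) x = (\<lambda>i. x (i + of_nat k))"
  by (induction k) (auto simp: shift_def algebra_simps)

lemma length_word_at [simp]: "length (word_at x i n) = n"
  by (simp add: word_at_def)

lemma word_at_eq_iff:
  "word_at x i n = word_at y j n \<longleftrightarrow> (\<forall>k<n. x (i + of_nat k) = y (j + of_nat k))"
  by (auto simp: word_at_def)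

lemma take_word_at: "m \<le> n \<Longrightarrow> take m (word_at x i n) = word_at x i m"
  by (simp add: word_at_def take_map take_upt)

lemma word_at_Suc: "word_at x i (Suc n) = x i # word_at x (i + 1) n"
  by (auto simp: word_at_def algebra_simps upt_conv_Cons map_Suc_upt[symmetric] simp del: upt_Suc)

lemma word_at_shift: "word_at (shift x) i n = word_at x (i + 1) n"
  by (simp add: word_at_def shift_def algebra_simps)

lemma word_at_in_language: "x \<in> X \<Longrightarrow> word_at x i n \<in> language X"
  by (auto simp: language_def)

lemma take_in_language:
  assumes "w \<in> language X"
  shows "take m w \<in> language X"
proof (cases "m \<le> length w")
  case True
  obtain x i n where "x \<in> X" "w = word_at x i n"
    using assms by (auto simp: language_def)
  with True show ?thesis by (simp add: take_word_at word_at_in_language)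
qed (use assms in simp)

lemma tl_in_language:
  assumes "w \<in> language X"
  shows "tl w \<in> language X"
proof -
  obtain x i n where x: "x \<in> X" "w = word_at x i n"
    using assms by (auto simp: language_def)
  show ?thesis
  proof (cases n)
    case 0
    with x assms show ?thesis by (simp add: word_at_def)
  next
    case (Suc m)
    with x show ?thesis by (simp add: word_at_Suc word_at_in_language)
  qed
qed

lemma word_at_prefix_in_language:
  "word_at x i n \<in> language X \<Longrightarrow> m \<le> n \<Longrightarrow> word_at x i m \<in> language X"
  using take_in_language[of "word_at x i n" X m] by (simp add: take_word_at)

section \<open>Closure, density and continuity expressed through finite words\<close>

lemma subshift_range: "subshift A X \<Longrightarrow> x \<in> X \<Longrightarrow> range x \<subseteq> A"
  using closedin_subset[of "full_shift A" X] by (auto simp: subshift_def topspace_full_shift)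

lemma funpow_shift_in_subshift: "subshift A X \<Longrightarrow> x \<in> X \<Longrightarrow> (shift ^^ k) x \<in> X"
  by (induction k) (auto simp: subshift_def)

text \<open>A prefix of \<open>x\<close> that occurs somewhere in a point of \<open>X\<close> occurs
  at index 0 of a shifted point, which is again in \<open>X\<close>. So points of \<open>X\<close>
  agree with \<open>x\<close> on arbitrarily long prefixes, and \<open>x\<close> lies in the closure
  of the closed set \<open>X\<close>.\<close>

lemma subshift_mem_iff:
  fixes X :: "(nat \<Rightarrow> 'a) set"
  assumes "subshift A X"
  shows "x \<in> X \<longleftrightarrow> (\<forall>n. word_at x 0 n \<in> language X)"
proof (intro iffI allI)
  assume x: "\<forall>n. word_at x 0 n \<in> language X"
  have approx: "\<exists>u\<in>X. \<forall>k<n. u k = x k" for n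
  proof -
    obtain u i where u: "u \<in> X" "word_at x 0 n = word_at u i n"
      using x unfolding language_def by (smt (verit) length_word_at mem_Collect_eq)
    then have "(shift ^^ i) u \<in> X" "\<forall>k<n. (shift ^^ i) u k = x k"
      by (auto simp: word_at_eq_iff funpow_shift_in_subshift[OF assms])
         (auto simp: funpow_shift add.commute)
    then show ?thesis by blast
  qed
  have rx: "range x \<subseteq> A"
  proof -
    have "x k \<in> A" for k
      using approx[of "Suc k"] subshift_range[OF assms] by (metis lessI range_subsetD)
    then show ?thesis by blast
  qed
  have "x \<in> full_shift A closure_of X"
    unfolding in_closure_of
  proof (intro conjI allI impI)
    show "x \<in> topspace (full_shift A)" using rx by (simp add: topspace_full_shift)
    fix T assume T: "x \<in> T \<and> openin (full_shift A) T"
    then obtain U where U: "x \<in> PiE UNIV U" "PiE UNIV U \<subseteq> T"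
        "finite {i. U i \<noteq> A}"
      using product_topology_open_contains_basis[of "\<lambda>_. discrete_topology A" UNIV T x]
      by (auto simp: full_shift_def)
    obtain n where n: "\<forall>i\<in>{i. U i \<noteq> A}. i < n"
      using U(3) finite_nat_set_iff_bounded by blast
    obtain u where u: "u \<in> X" "\<forall>k<n. u k = x k" using approx by blast
    have "u k \<in> U k" for k
      using n u U(1) subshift_range[OF assms u(1)] by (cases "U k = A") (auto simp: PiE_iff)
    then have "u \<in> PiE UNIV U" by (simp add: PiE_iff)
    then show "\<exists>u. u \<in> X \<and> u \<in> T" using u(1) U(2) by blast
  qed
  then show "x \<in> X" using assms by (simp add: subshift_def closure_of_closedin)
qed (rule word_at_in_language)

text \<open>Shifting an occurrence of \<open>w\<close> to index 0 gives a point \<open>?v\<close> of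
  \<open>X\<close>; the dense orbit of \<open>x\<close> must meet the cylinder of \<open>w\<close>
  around it.\<close>

lemma minimal_word_occurs:
  fixes X :: "(nat \<Rightarrow> 'a) set"
  assumes "subshift A X" "minimal_one_sided A X" "x \<in> X" "w \<in> language X"
  shows "\<exists>i. word_at x i (length w) = w"
proof -
  obtain u j n where u: "u \<in> X" "w = word_at u j n"
    using assms(4) by (auto simp: language_def)
  let ?v = "(shift ^^ j) u"
  have v: "?v \<in> X" by (rule funpow_shift_in_subshift[OF assms(1) u(1)])
  let ?C = "{z. range z \<subseteq> A \<and> (\<forall>i\<in>{..<n}. z i = ?v i)}"
  have "openin (full_shift A) ?C"
    using subshift_range[OF assms(1) v] by (intro openin_full_shift_cylinder) auto
  then have op: "openin (subshift_topology A X) (?C \<inter> X)"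
    by (auto simp: openin_subtopology)
  have mem: "?v \<in> ?C \<inter> X" using v subshift_range[OF assms(1) v] by auto
  have "?v \<in> subshift_topology A X closure_of (range (\<lambda>n. (shift ^^ n) x))"
    using assms(2,3) v by (simp add: minimal_one_sided_def)
  then have "\<exists>y. y \<in> range (\<lambda>n. (shift ^^ n) x) \<and> y \<in> T"
    if "?v \<in> T" "openin (subshift_topology A X) T" for T
    using that by (simp only: in_closure_of)
  from this[OF mem op] obtain k where "(shift ^^ k) x \<in> ?C" by blast
  then have "word_at x k n = w"
    using u by (auto simp: word_at_eq_iff funpow_shift add.commute)
  then show ?thesis using u by auto
qed

text \<open>The Curtis-Hedlund-Lyndon argument, without commutation with the shift: coordinate
  \<open>j\<close> of \<open>f\<close> is locally constant, hence determined on a cylinder around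
  each point, and by compactness finitely many such cylinders cover \<open>Y\<close>. The union of
  their index sets is the window.\<close>

lemma continuous_map_finite_window:
  fixes Y :: "('i::semiring_1 \<Rightarrow> 'a) set"
  assumes "finite A" "subshift A Y"
    and f: "continuous_map (subshift_topology A Y) (subshift_topology A Y) f"
  shows "\<exists>F. finite F \<and> (\<forall>y\<in>Y. \<forall>y'\<in>Y. (\<forall>i\<in>F. y i = y' i) \<longrightarrow> f y j = f y' j)"
proof -
  note rng = subshift_range[OF assms(2)]
  note top = topspace_subshift[OF assms(1,2)]
  have fY: "f y \<in> Y" if "y \<in> Y" for y
    using f that top by (auto simp: continuous_map_def Pi_iff)
  have "\<exists>F. finite F \<and> (\<forall>z\<in>Y. (\<forall>i\<in>F. z i = y i) \<longrightarrow> f z j = f y j)" if y: "y \<in> Y" for y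
  proof -
    let ?C = "{z. range z \<subseteq> A \<and> (\<forall>i\<in>{j}. z i = f y i)}"
    have "openin (full_shift A) ?C"
      using rng[OF fY[OF y]] by (intro openin_full_shift_cylinder) auto
    then have "openin (subshift_topology A Y) (?C \<inter> Y)"
      by (auto simp: openin_subtopology)
    then have "openin (subshift_topology A Y) {z \<in> Y. f z \<in> ?C \<inter> Y}"
      using openin_continuous_map_preimage[OF f] by (simp only: top)
    then obtain W where W: "openin (full_shift A) W" "{z \<in> Y. f z \<in> ?C \<inter> Y} = W \<inter> Y"
      by (auto simp: openin_subtopology)
    have "y \<in> {z \<in> Y. f z \<in> ?C \<inter> Y}" using y fY[OF y] rng[OF fY[OF y]] by auto
    then have "y \<in> W" using W(2) by blast
    then obtain U where U: "y \<in> PiE UNIV U" "PiE UNIV U \<subseteq> W" "finite {i. U i \<noteq> A}"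
      using product_topology_open_contains_basis[of "\<lambda>_. discrete_topology A" UNIV W y] W(1)
      by (auto simp: full_shift_def)
    have "f z j = f y j" if z: "z \<in> Y" "\<forall>i\<in>{i. U i \<noteq> A}. z i = y i" for z
    proof -
      have "z i \<in> U i" for i
        using z U(1) rng[OF z(1)] by (cases "U i = A") (auto simp: PiE_iff)
      then have "z \<in> W \<inter> Y" using z(1) U(2) by (auto simp: PiE_iff)
      then have "f z \<in> ?C" using W(2) by blast
      then show ?thesis by simp
    qed
    then show ?thesis using U(3) by blast
  qed
  then obtain F where F: "\<And>y. y \<in> Y \<Longrightarrow> finite (F y)"
      "\<And>y z. y \<in> Y \<Longrightarrow> z \<in> Y \<Longrightarrow> (\<forall>i\<in>F y. z i = y i) \<Longrightarrow> f z j = f y j"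
    by metis
  define C where "C y = {z. range z \<subseteq> A \<and> (\<forall>i\<in>F y. z i = y i)}" for y
  have "compactin (full_shift A) Y"
    using compact_space_subshift[OF assms(1,2)] assms(2)
    by (auto simp: compactin_subspace subshift_def dest: closedin_subset)
  moreover have "openin (full_shift A) U" if "U \<in> C ` Y" for U
    using that F(1) rng unfolding C_def by (auto intro!: openin_full_shift_cylinder)
  moreover have "Y \<subseteq> \<Union> (C ` Y)" using rng by (auto simp: C_def)
  ultimately obtain D where D: "finite D" "D \<subseteq> Y" "Y \<subseteq> \<Union> (C ` D)"
    by (smt (verit, ccfv_threshold) compactin_def finite_subset_image)
  have "f u j = f v j" if uv: "u \<in> Y" "v \<in> Y" "\<forall>i\<in>\<Union> (F ` D). u i = v i" for u v
  proof -
    \<comment> \<open>\<open>v\<close> agrees with \<open>u\<close> on \<open>F y\<close>, so both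
      lie in the cylinder around the same centre \<open>y\<close>, and both values equal
      \<open>f y j\<close>.\<close>
    obtain y where y: "y \<in> D" "u \<in> C y" using uv(1) D(3) by blast
    then have "\<forall>i\<in>F y. u i = y i" by (simp add: C_def)
    moreover from this have "\<forall>i\<in>F y. v i = y i" using uv(3) y(1) by force
    ultimately show ?thesis using F(2) uv(1,2) y(1) D(2) by (metis subsetD)
  qed
  moreover have "finite (\<Union> (F ` D))" using D F(1) by auto
  ultimately show ?thesis by blast
qed

section \<open>The left special point\<close>

definition left_special :: "('i::semiring_1 \<Rightarrow> 'a) set \<Rightarrow> 'a list \<Rightarrow> bool"
  where "left_special X w \<longleftrightarrow> (\<exists>a b. a \<noteq> b \<and> a # w \<in> language X \<and> b # w \<in> language X)"

lemma left_special_take: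
  assumes "left_special X w"
  shows "left_special X (take m w)"
proof -
  obtain a b where "a \<noteq> b" "a # w \<in> language X" "b # w \<in> language X"
    using assms by (auto simp: left_special_def)
  then have "a # take m w \<in> language X" "b # take m w \<in> language X"
    using take_in_language[of _ X "Suc m"] by fastforce+
  then show ?thesis using \<open>a \<noteq> b\<close> by (auto simp: left_special_def)
qed

section \<open>Words of a Sturmian shift and their left extensions\<close>

locale sturmian =
  fixes A :: "'a set" and X :: "(nat \<Rightarrow> 'a) set"
  assumes finite_A: "finite A" and sturmian: "sturmian_one_sided A X"
begin

abbreviation "words n \<equiv> {w \<in> language X. length w = n}"

lemma subshift_X: "subshift A X"
  and minimal_X: "minimal_one_sided A X"
  using sturmian by (auto simp: sturmian_one_sided_def)

lemma card_words: "n \<ge> 1 \<Longrightarrow> card (words n) = n + 1"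
  using sturmian by (auto simp: sturmian_one_sided_def complexity_def)

lemma finite_words: "n \<ge> 1 \<Longrightarrow> finite (words n)"
  using card_words[of n] by (intro card_ge_0_finite) simp

lemma X_nonempty: "X \<noteq> {}"
  using sturmian by (auto simp: sturmian_one_sided_def)

lemmas X_mem_iff = subshift_mem_iff[OF subshift_X]

lemma word_occurs: "x \<in> X \<Longrightarrow> w \<in> language X \<Longrightarrow> \<exists>i. word_at x i (length w) = w"
  by (rule minimal_word_occurs[OF subshift_X minimal_X])

text \<open>An occurrence of \<open>w\<close> in \<open>shift x\<close> always has a letter of
  \<open>x\<close> to its left, whereas an occurrence in \<open>x\<close> could start at index
  0.\<close>

lemma left_extension:
  assumes "w \<in> language X"
  shows "\<exists>a. a # w \<in> language X"
proof -
  obtain x where x: "x \<in> X" using X_nonempty by blast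
  then have "shift x \<in> X" using subshift_X by (auto simp: subshift_def)
  then obtain i where "word_at (shift x) i (length w) = w"
    using word_occurs assms by blast
  then have "word_at x i (Suc (length w)) = x i # w"
    by (simp add: word_at_Suc word_at_shift)
  then show ?thesis using word_at_in_language[OF x] by metis
qed

lemma tl_words: "tl ` words (Suc n) = words n"
proof
  show "tl ` words (Suc n) \<subseteq> words n" using tl_in_language by auto
  show "words n \<subseteq> tl ` words (Suc n)"
  proof
    fix w assume w: "w \<in> words n"
    then obtain a where "a # w \<in> language X" using left_extension by blast
    then show "w \<in> tl ` words (Suc n)" using w by (intro image_eqI[of _ _ "a # w"]) auto
  qed
qed

text \<open>\<open>tl\<close> maps \<open>n + 2\<close> words onto \<open>n + 1\<close> words, so
  two words share a tail; they differ in the first letter, which makes this tail left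
  special.\<close>

lemma left_special_exists:
  assumes "n \<ge> 1"
  shows "\<exists>w. length w = n \<and> left_special X w"
proof (rule ccontr)
  assume no: "\<not> ?thesis"
  have "inj_on tl (words (Suc n))"
  proof (rule inj_onI)
    fix u v assume u: "u \<in> words (Suc n)" and v: "v \<in> words (Suc n)" and t: "tl u = tl v"
    then have eq: "u = hd u # tl u" "v = hd v # tl u" "length (tl u) = n"
      by (auto, metis length_0_conv list.collapse nat.distinct(1),
          metis length_0_conv list.collapse nat.distinct(1))
    then have "hd u = hd v"
      using no u v unfolding left_special_def by (metis (mono_tags, lifting) mem_Collect_eq)
    then show "u = v" using eq by metis
  qed
  then have "card (words (Suc n)) = card (words n)"
    using card_image[of tl "words (Suc n)"] unfolding tl_words by simp
  then show False using card_words[OF assms] card_words[of "Suc n"] by simp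
qed

lemma left_special_unique:
  assumes "left_special X u" "left_special X v" "length u = length v"
  shows "u = v"
proof (rule ccontr)
  assume ne: "u \<noteq> v"
  \<comment> \<open>Two left special words would allow two words of length \<open>n + 1\<close> to be dropped while \<^const>\<open>tl\<close>
    still maps onto the words of length \<open>n\<close>.\<close>
  define n where "n = length u"
  have n: "n \<ge> 1" "length u = n" "length v = n" using ne assms(3) by (cases u; auto simp: n_def)+
  obtain a b where a: "a \<noteq> b" "a # u \<in> language X" "b # u \<in> language X"
    using assms(1) by (auto simp: left_special_def)
  obtain c d where c: "c \<noteq> d" "c # v \<in> language X" "d # v \<in> language X"
    using assms(2) by (auto simp: left_special_def)
  let ?W = "words (Suc n) - {a # u, c # v}"
  have "words n \<subseteq> tl ` ?W"
  proof
    fix w assume w: "w \<in> words n"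
    then obtain w' where w': "w' \<in> words (Suc n)" "w = tl w'" using tl_words[of n] by blast
    consider "w = u" | "w = v" | "w \<noteq> u" "w \<noteq> v" by blast
    then show "w \<in> tl ` ?W"
    proof cases
      case 1
      then show ?thesis using a n ne by (intro image_eqI[of _ _ "b # u"]) auto
    next
      case 2
      then show ?thesis using c n ne by (intro image_eqI[of _ _ "d # v"]) auto
    next
      case 3
      then show ?thesis using w' by auto
    qed
  qed
  moreover have fin: "finite (words (Suc n))" by (rule finite_words) simp
  ultimately have "card (words n) \<le> card ?W"
    by (meson card_image_le card_mono finite_Diff finite_imageI le_trans)
  also have "card ?W = card (words (Suc n)) - card {a # u, c # v}"
    using a c n by (intro card_Diff_subset) auto
  also have "card {a # u, c # v} = 2" using ne by auto
  finally show False using card_words[OF n(1)] card_words[of "Suc n"] by simp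
qed

text \<open>The left special words of different lengths are prefixes of each other, so each letter
  can be read off as the last letter of the shortest left special word that reaches it.\<close>

definition special_point :: "nat \<Rightarrow> 'a"
  where "special_point k = (THE w. length w = Suc k \<and> left_special X w) ! k"

text \<open>Prefixes of a left special word are left special, so by uniqueness they are the words
  that define \<open>special_point\<close>. Conversely, the prefix of \<open>special_point\<close>
  of a given length is cut from some left special word.\<close>

lemma left_special_iff_special_point:
  "left_special X w \<longleftrightarrow> w = word_at special_point 0 (length w)"
proof -
  have imp: "w = word_at special_point 0 (length w)" if w: "left_special X w" for w
  proof (rule nth_equalityI)
    fix k assume k: "k < length w"
    have "(THE w. length w = Suc k \<and> left_special X w) = take (Suc k) w"
      using k left_special_take[OF w, of "Suc k"] left_special_unique
      by (intro the_equality) auto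
    then show "w ! k = word_at special_point 0 (length w) ! k"
      using k by (simp add: word_at_def special_point_def)
  qed simp
  moreover have "left_special X w" if w: "w = word_at special_point 0 (length w)"
  proof -
    \<comment> \<open>One letter more than \<open>w\<close>, since existence is available for
      positive lengths only and \<open>w\<close> may be empty.\<close>
    obtain v where v: "length v = Suc (length w)" "left_special X v"
      using left_special_exists[of "Suc (length w)"] by auto
    have "take (length w) v = word_at special_point 0 (length w)"
      by (subst imp[OF v(2)]) (simp add: v(1) take_word_at)
    then have "take (length w) v = w" using w by (rule trans[OF _ sym])
    then show ?thesis using left_special_take[OF v(2)] by metis
  qed
  ultimately show ?thesis by blast
qed

text \<open>Distinct points with the same shift differ exactly at index 0, so every prefix of the
  common image is preceded by two different letters.\<close>

lemma eq_special_point: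
  assumes "u \<in> X" "v \<in> X" "u \<noteq> v" "shift u = shift v"
  shows "shift u = special_point"
proof
  fix k
  have ne: "u 0 \<noteq> v 0"
  proof
    assume 0: "u 0 = v 0"
    have "u i = v i" for i
      using 0 fun_cong[OF assms(4), of "i - 1"] by (cases i) (auto simp: shift_def)
    with assms(3) show False by blast
  qed
  let ?w = "word_at (shift u) 0 (Suc k)"
  have "word_at x 0 (Suc (Suc k)) = x 0 # word_at (shift x) 0 (Suc k)" for x :: "nat \<Rightarrow> 'a"
    by (subst word_at_Suc) (simp add: word_at_shift)
  then have "u 0 # ?w \<in> language X" "v 0 # ?w \<in> language X"
    using word_at_in_language assms by metis+
  then have "left_special X ?w" using ne by (auto simp: left_special_def)
  then show "shift u k = special_point k"
    unfolding left_special_iff_special_point by (simp add: word_at_eq_iff)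
qed

text \<open>This is \<open>p(1) = 2\<close>. With only two candidates, a letter that extends each
  prefix separately can be chosen uniformly for all prefixes.\<close>

lemma two_letters: "\<exists>a b. \<forall>c w. c # w \<in> language X \<longrightarrow> c = a \<or> c = b"
proof -
  have "card (words 1) = 2" using card_words[of 1] by simp
  then obtain u v where uv: "words 1 = {u, v}" unfolding card_2_iff by blast
  have "u \<in> words 1" "v \<in> words 1" using uv by blast+
  then obtain a b where ab: "u = [a]" "v = [b]" by (auto simp: length_Suc_conv)
  show ?thesis
  proof (intro exI allI impI)
    fix c w assume "c # w \<in> language X"
    from take_in_language[OF this, of 1] have "[c] \<in> words 1" by simp
    then show "c = a \<or> c = b" unfolding uv ab by simp
  qed
qed

section \<open>Preimages under the one-sided shift\<close>

lemma case_nat_in_X: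
  assumes "\<And>n. a # word_at x 0 n \<in> language X"
  shows "case_nat a x \<in> X"
proof -
  have eq: "word_at (case_nat a x) 0 (Suc n) = a # word_at x 0 n" for n
    unfolding word_at_Suc by (simp add: word_at_def)
  have "word_at (case_nat a x) 0 n \<in> language X" for n
    using word_at_prefix_in_language[of "case_nat a x" 0 "Suc n" X n] assms[of n] by (simp add: eq)
  then show ?thesis by (simp add: X_mem_iff)
qed

lemma shift_case_nat [simp]: "shift (case_nat a x) = (x :: nat \<Rightarrow> 'a)"
  by (simp add: shift_def)

text \<open>Every prefix of \<open>special_point\<close> is preceded by two distinct letters, and
  only \<open>a\<close> and \<open>b\<close> are possible. So both precede all prefixes, and both
  one-letter extensions of the point lie in \<open>X\<close>.\<close>

lemma special_point_preimages:
  obtains u v where "u \<in> X" "v \<in> X" "u \<noteq> v" "shift u = special_point" "shift v = special_point"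
proof -
  have ls: "left_special X (word_at special_point 0 n)" for n
    by (simp add: left_special_iff_special_point)
  obtain a b where ab: "\<forall>c w. c # w \<in> language X \<longrightarrow> c = a \<or> c = b"
    using two_letters by blast
  have "a # word_at special_point 0 n \<in> language X \<and> b # word_at special_point 0 n \<in> language X" for n
    using ls[of n] ab unfolding left_special_def by metis
  then have "case_nat a special_point \<in> X" "case_nat b special_point \<in> X"
    by (auto intro: case_nat_in_X)
  moreover have "case_nat a special_point \<noteq> case_nat b special_point"
  proof -
    \<comment> \<open>The empty prefix is left special, so two different letters occur.\<close>
    have "a \<noteq> b" using ls[of 0] ab unfolding left_special_def by metis
    then show ?thesis by (auto dest: fun_cong[of _ _ 0])
  qed
  ultimately show ?thesis using that by auto
qed

lemma special_point_in_X: "special_point \<in> X"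
proof -
  obtain u where "u \<in> X" "shift u = special_point" using special_point_preimages by blast
  then show ?thesis using funpow_shift_in_subshift[OF subshift_X, of u 1] by simp
qed

text \<open>A pigeonhole form of compactness: a letter that precedes a long prefix also precedes all
  shorter ones. If \<open>a\<close> failed at length \<open>m\<close> and \<open>b\<close> at length
  \<open>n\<close>, no letter could precede the prefix of length \<open>max m n\<close>.\<close>

lemma shift_preimage:
  assumes x: "x \<in> X"
  shows "\<exists>u\<in>X. shift u = x"
proof -
  obtain a b where ab: "\<forall>c w. c # w \<in> language X \<longrightarrow> c = a \<or> c = b"
    using two_letters by blast
  have mono: "c # word_at x 0 m \<in> language X" if "c # word_at x 0 n \<in> language X" "m \<le> n" for c m n
    using take_in_language[OF that(1), of "Suc m"] that(2) by (simp add: take_word_at)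
  have ext: "\<exists>c. c # word_at x 0 n \<in> language X" for n
    using left_extension word_at_in_language[OF x] by blast
  have "\<exists>c. \<forall>n. c # word_at x 0 n \<in> language X"
  proof (rule ccontr)
    assume "\<not> ?thesis"
    then obtain m n where "a # word_at x 0 m \<notin> language X" "b # word_at x 0 n \<notin> language X"
      by blast
    moreover obtain c where c: "c # word_at x 0 (max m n) \<in> language X" using ext by blast
    moreover have "c = a \<or> c = b" using ab c by blast
    ultimately show False using mono[OF c, of m] mono[OF c, of n] by auto
  qed
  then show ?thesis using case_nat_in_X shift_case_nat by metis
qed

section \<open>Automorphisms\<close>

text \<open>\<open>f\<close> fixes the whole orbit of \<open>special_point\<close>, and some orbit
  point agrees with \<open>x\<close> on the window that determines \<open>f x j\<close>.\<close>

lemma fixes_special_point_imp_id: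
  assumes f: "continuous_map (subshift_topology A X) (subshift_topology A X) f"
    and comm: "\<And>x. x \<in> X \<Longrightarrow> f (shift x) = shift (f x)"
    and fixed: "f special_point = special_point" and x: "x \<in> X"
  shows "f x = x"
proof
  fix j
  have orbit: "f ((shift ^^ k) special_point) = (shift ^^ k) special_point" for k
    by (induction k) (auto simp: fixed comm funpow_shift_in_subshift[OF subshift_X special_point_in_X])
  obtain F where F: "finite F"
      "\<And>y y'. y \<in> X \<Longrightarrow> y' \<in> X \<Longrightarrow> (\<forall>i\<in>F. y i = y' i) \<Longrightarrow> f y j = f y' j"
    using continuous_map_finite_window[OF finite_A subshift_X f] by metis
  \<comment> \<open>The bound also covers \<open>j\<close>, because the orbit point must agree with
    \<open>x\<close> at the output coordinate as well.\<close>
  obtain n where n: "\<forall>i\<in>insert j F. i < n"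
    using F(1) finite_nat_set_iff_bounded by (metis finite_insert)
  obtain k where k: "word_at special_point k n = word_at x 0 n"
    using word_occurs[OF special_point_in_X word_at_in_language[OF x, of 0 n]] by auto
  let ?u = "(shift ^^ k) special_point"
  have u: "?u i = x i" if "i < n" for i
    using k that by (auto simp: word_at_eq_iff funpow_shift add.commute)
  have "f x j = f ?u j"
    using u n by (intro F(2) x funpow_shift_in_subshift[OF subshift_X special_point_in_X]) auto
  then show "f x j = x j" using orbit u n by simp
qed

text \<open>An automorphism sends the two preimages of \<open>special_point\<close> to two distinct
  preimages of \<open>f special_point\<close>, which is therefore \<open>special_point\<close> by
  \<open>eq_special_point\<close>.\<close>

lemma trivial_Aut_one_sided: "trivial_group (Aut_shift A X)"
proof -
  interpret G: group "Aut_shift A X" by (rule group_Aut_shift[OF finite_A subshift_X])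
  have one: "\<one>\<^bsub>Aut_shift A X\<^esub> = (\<lambda>x\<in>X. x)"
    by (simp add: Aut_shift_def BijGroup_def)
  have "carrier (Aut_shift A X) \<subseteq> {\<one>\<^bsub>Aut_shift A X\<^esub>}"
  proof
    fix f assume f: "f \<in> carrier (Aut_shift A X)"
    have B: "f \<in> extensional X" "bij_betw f X X"
      and c: "continuous_map (subshift_topology A X) (subshift_topology A X) f"
      and s: "\<And>x. x \<in> X \<Longrightarrow> f (shift x) = shift (f x)"
      using f by (auto simp: Aut_shift_def Bij_def)
    obtain u v where uv: "u \<in> X" "v \<in> X" "u \<noteq> v" "shift u = special_point" "shift v = special_point"
      using special_point_preimages by blast
    have "f u \<in> X" "f v \<in> X" "f u \<noteq> f v"
      using B(2) uv by (auto simp: bij_betw_def inj_on_def)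
    then have "f special_point = special_point"
      using eq_special_point[of "f u" "f v"] s uv by metis
    then have id: "f x = x" if "x \<in> X" for x
      using fixes_special_point_imp_id[OF c s _ that] by blast
    have "f = \<one>\<^bsub>Aut_shift A X\<^esub>"
      unfolding one by (rule extensionalityI[OF B(1)]) (simp_all add: id)
    then show "f \<in> {\<one>\<^bsub>Aut_shift A X\<^esub>}" by simp
  qed
  then have "carrier (Aut_shift A X) = {\<one>\<^bsub>Aut_shift A X\<^esub>}"
    using G.one_closed by blast
  then show ?thesis
    by (simp add: trivial_group_def G.group_axioms)
qed

section \<open>Two-sided points and their automorphisms\<close>

abbreviation "Y \<equiv> two_sided_version X"

lemma subshift_Y: "subshift A Y"
  by (rule subshift_two_sided_version[OF subshift_X])

text \<open>Every prefix of a right half is a word of \<open>y\<close>. This makes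
  \<open>eq_special_point\<close> applicable to two-sided points.\<close>

lemma right_half_in_X:
  assumes "y \<in> Y"
  shows "(\<lambda>n. y (int n + i)) \<in> X"
proof -
  have "word_at (\<lambda>n. y (int n + i)) 0 n = word_at y i n" for n
    by (auto simp: word_at_def add.commute)
  then show ?thesis using assms by (simp add: X_mem_iff two_sided_version_def)
qed

lemma translate_in_Y:
  assumes "y \<in> Y"
  shows "(\<lambda>i. y (i + k)) \<in> Y"
proof -
  have "word_at (\<lambda>i. y (i + k)) i n = word_at y (i + k) n" for i n
    by (simp add: word_at_def algebra_simps)
  then show ?thesis using assms by (simp add: two_sided_version_def)
qed

text \<open>\<open>x\<close> is extended to the left by iterating a choice \<open>p\<close> of
  preimages, each of which adds one letter in front.\<close>

lemma two_sided_extension: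
  assumes x: "x \<in> X"
  shows "\<exists>y\<in>Y. \<forall>n. y (int n) = x n"
proof -
  obtain p where p: "\<And>u. u \<in> X \<Longrightarrow> p u \<in> X \<and> shift (p u) = u"
    using shift_preimage by metis
  have pX: "(p ^^ k) x \<in> X" for k by (induction k) (auto simp: x p)
  have step: "(p ^^ Suc k) x (Suc m) = (p ^^ k) x m" for k m
    using p[OF pX[of k]] by (auto simp: shift_def dest: fun_cong[of _ _ m])
  have add: "(p ^^ (d + k)) x (d + m) = (p ^^ k) x m" for d k m
  proof (induction d)
    case (Suc d)
    then show ?case using step[of "d + k" "d + m"] by simp
  qed simp
  \<comment> \<open>For \<open>i \<ge> 0\<close> the exponent is 0 and the letter is
    \<open>x (nat i)\<close>; for \<open>i < 0\<close> it is the first letter of the preimage number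
    \<open>- i\<close>.\<close>
  define y where "y i = (p ^^ nat (- i)) x (nat i)" for i :: int
  \<comment> \<open>Any sufficiently deep preimage shows the same letter, so a whole word of
    \<open>y\<close> can be found inside one point of \<open>X\<close>.\<close>
  have y: "y i = (p ^^ k) x (nat (i + int k))" if "i + int k \<ge> 0" for i k
  proof (cases "i \<ge> 0")
    case True
    then show ?thesis using add[of k 0 "nat i"] by (simp add: y_def nat_add_distrib add.commute)
  next
    case False
    define d where "d = nat (i + int k)"
    have "k = d + nat (- i)" using False that by (simp add: d_def)
    then show ?thesis using add[of d "nat (- i)" 0] False by (simp add: y_def d_def[symmetric])
  qed
  have "word_at y i n \<in> language X" for i n
  proof -
    define k where "k = nat (- i)"
    have "y (i + int j) = (p ^^ k) x (nat (i + int k) + j)" for j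
    proof -
      have "i + int j + int k \<ge> 0" "nat (i + int j + int k) = nat (i + int k) + j"
        unfolding k_def by linarith+
      then show ?thesis using y by metis
    qed
    then have "word_at y i n = word_at ((p ^^ k) x) (nat (i + int k)) n"
      by (simp add: word_at_eq_iff)
    then show ?thesis using word_at_in_language[OF pX] by metis
  qed
  then have "y \<in> Y" by (simp add: two_sided_version_def)
  moreover have "y (int n) = x n" for n by (simp add: y_def)
  ultimately show ?thesis by blast
qed

lemma commutes_translate:
  assumes s: "\<And>y. y \<in> Y \<Longrightarrow> f (shift y) = shift (f y)" and y: "y \<in> Y"
  shows "f (\<lambda>i. y (i + k)) = (\<lambda>i. f y (i + k))"
proof (induction k rule: int_induct[where k = 0])
  case (step1 k)
  have "f (shift (\<lambda>i. y (i + k))) = shift (f (\<lambda>i. y (i + k)))"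
    by (intro s translate_in_Y y)
  then show ?case using step1 by (simp add: shift_def algebra_simps)
next
  case (step2 k)
  have "shift (\<lambda>i. y (i + (k - 1))) = (\<lambda>i. y (i + k))" by (simp add: shift_def algebra_simps)
  then have "f (\<lambda>i. y (i + k)) = shift (f (\<lambda>i. y (i + (k - 1))))"
    using s translate_in_Y[OF y] by metis
  \<comment> \<open>Evaluating the shifted equation at \<open>i - 1\<close> cancels the shift and
    gives the step to smaller \<open>k\<close>.\<close>
  then have "f (\<lambda>i. y (i + (k - 1))) (i - 1 + 1) = f y (i - 1 + k)" for i
    using step2 by (simp add: shift_def fun_eq_iff)
  then show ?case by (auto simp: algebra_simps)
qed simp

text \<open>The witness is \<open>- m\<close>: the pair \<open>a\<close>, \<open>b\<close> last
  differs at 0, and its image under \<open>f\<close> last differs at \<open>m\<close>.\<close>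

lemma automorphism_is_translation:
  assumes f: "continuous_map (subshift_topology A Y) (subshift_topology A Y) f"
    and bij: "bij_betw f Y Y"
    and s: "\<And>y. y \<in> Y \<Longrightarrow> f (shift y) = shift (f y)"
  shows "\<exists>n. \<forall>y\<in>Y. f y = (\<lambda>i. y (i + n))"
proof -
  have comm: "f (\<lambda>i. y (i + k)) = (\<lambda>i. f y (i + k))" if "y \<in> Y" for y k
    by (rule commutes_translate[OF _ that]) (rule s)
  obtain u v where uv: "u \<in> X" "v \<in> X" "u \<noteq> v" "shift u = special_point" "shift v = special_point"
    using special_point_preimages by blast
  obtain a b where ab: "a \<in> Y" "b \<in> Y" "\<And>n. a (int n) = u n" "\<And>n. b (int n) = v n"
    using two_sided_extension uv(1,2) by metis
  have special: "a (int n + 1) = special_point n" "b (int n + 1) = special_point n" for n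
    using uv(4,5) ab(3)[of "Suc n"] ab(4)[of "Suc n"]
    by (auto simp: shift_def add.commute dest: fun_cong[of _ _ n])
  have ab_eq: "a i = b i" if "i \<ge> 1" for i
    using special[of "nat (i - 1)"] that by simp
  have "a \<noteq> b" using uv(3) ab(3,4) by (metis ext)
  then have "f a \<noteq> f b" using bij ab(1,2) by (auto simp: bij_betw_def inj_on_def)
  then obtain m0 where m0: "f a m0 \<noteq> f b m0" by blast
  obtain F where F: "finite F"
      "\<And>y y'. y \<in> Y \<Longrightarrow> y' \<in> Y \<Longrightarrow> (\<forall>i\<in>F. y i = y' i) \<Longrightarrow> f y 0 = f y' 0"
    using continuous_map_finite_window[OF finite_A subshift_Y f, of 0] by metis
  \<comment> \<open>The window for coordinate \<open>i\<close> starts no earlier than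
    \<open>i + r\<close>. Once \<open>i \<ge> 1 - r\<close>, it lies in the range where
    \<open>a\<close> and \<open>b\<close> agree.\<close>
  obtain r where r: "\<forall>i\<in>F. i \<ge> r"
    using F(1) by (metis bdd_below_finite bdd_below.unfold)
  have fab: "f a i = f b i" if "i \<ge> 1 - r" for i
  proof -
    have "f (\<lambda>j. a (j + i)) 0 = f (\<lambda>j. b (j + i)) 0"
      using r that by (intro F(2)[OF translate_in_Y[OF ab(1)] translate_in_Y[OF ab(2)]] ballI ab_eq) force
    then show ?thesis using comm ab by simp
  qed
  obtain m where m: "f a m \<noteq> f b m" "\<And>i. i > m \<Longrightarrow> f a i = f b i"
  proof -
    \<comment> \<open>The images agree from \<open>1 - r\<close> on, so all differences from
      \<open>m0\<close> onwards lie in this finite set, and its maximum is the last one.\<close>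
    let ?S = "{i \<in> {m0..1 - r}. f a i \<noteq> f b i}"
    have S: "finite ?S" by (rule finite_subset[of _ "{m0..1 - r}"]) auto
    have m0_S: "m0 \<in> ?S" using m0 fab[of m0] by force
    then have "Max ?S \<in> ?S" using Max_in[OF S] by blast
    moreover have "f a i = f b i" if i: "i > Max ?S" for i
    proof (rule ccontr)
      assume ne: "f a i \<noteq> f b i"
      moreover have "m0 \<le> Max ?S" using S m0_S by (rule Max_ge)
      ultimately have "i \<in> ?S" using i fab[of i] by force
      then show False using Max_ge[OF S] i by (meson leD)
    qed
    ultimately show ?thesis using that[of "Max ?S"] by blast
  qed
  have fY: "f a \<in> Y" "f b \<in> Y" using bij ab by (auto simp: bij_betw_def)
  \<comment> \<open>Read from \<open>m\<close>, the two images are distinct points of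
    \<open>X\<close> with the same shift. So \<open>f a\<close> continues as
    \<open>special_point\<close> from \<open>m + 1\<close>, just as \<open>a\<close> does from
    1.\<close>
  have "shift (\<lambda>n. f a (int n + m)) = special_point"
  proof (rule eq_special_point[OF right_half_in_X[OF fY(1)] right_half_in_X[OF fY(2)]])
    show "(\<lambda>n. f a (int n + m)) \<noteq> (\<lambda>n. f b (int n + m))"
      using m(1) by (auto dest: fun_cong[of _ _ 0])
    show "shift (\<lambda>n. f a (int n + m)) = shift (\<lambda>n. f b (int n + m))"
      using m(2) by (auto simp: shift_def)
  qed
  then have fa: "f a (int n + 1 + m) = special_point n" for n
    by (auto simp: shift_def add.commute add.left_commute dest: fun_cong[of _ _ n])
  \<comment> \<open>For \<open>a\<close> and its translates by \<open>t \<ge> 1\<close> this is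
    known from \<open>fa\<close> and \<open>special\<close>. For general \<open>y\<close>, a central
    block of \<open>y\<close> that determines \<open>f y m\<close> is found again in
    \<open>a\<close> at such a \<open>t\<close>.\<close>
  have at_m: "f y m = y 0" if y: "y \<in> Y" for y
  proof -
    obtain F' where F': "finite F'"
        "\<And>y y'. y \<in> Y \<Longrightarrow> y' \<in> Y \<Longrightarrow> (\<forall>i\<in>F'. y i = y' i) \<Longrightarrow> f y m = f y' m"
      using continuous_map_finite_window[OF finite_A subshift_Y f, of m] by metis
    \<comment> \<open>Including 0 makes \<open>q\<close> nonnegative and puts index 0 into the
      block, so that \<open>y 0\<close> can be read off in \<open>a\<close> too.\<close>
    define q where "q = Max (abs ` insert 0 F')"
    have q: "\<bar>i\<bar> \<le> q" if "i \<in> insert 0 F'" for i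
      unfolding q_def using F'(1) that by (intro Max_ge) auto
    let ?l = "nat (2 * q + 1)"
    have "word_at y (- q) ?l \<in> language X" using y by (simp add: two_sided_version_def)
    then obtain k where k: "word_at special_point k ?l = word_at y (- q) ?l"
      using word_occurs[OF special_point_in_X] by (metis length_word_at)
    \<comment> \<open>The block starts at \<open>- q\<close> in \<open>y\<close> and at
      \<open>k\<close> in \<open>special_point\<close>, whose index \<open>k\<close> is index
      \<open>k + 1\<close> of \<open>a\<close>.\<close>
    define t where "t = int k + 1 + q"
    have win: "a (i + t) = y i" if i: "\<bar>i\<bar> \<le> q" for i
    proof -
      have "special_point (k + nat (i + q)) = y (- q + int (nat (i + q)))"
        using k i by (auto simp: word_at_eq_iff)
      moreover have "int (k + nat (i + q)) + 1 = i + t" "- q + int (nat (i + q)) = i"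
        using i by (auto simp: t_def)
      ultimately show ?thesis using special(1)[of "k + nat (i + q)"] by metis
    qed
    have t_eq: "t = int (k + nat q) + 1" using q[of 0] by (simp add: t_def)
    have "f y m = f (\<lambda>i. a (i + t)) m"
      using win q by (intro F'(2)[OF y translate_in_Y[OF ab(1)]]) auto
    also have "\<dots> = f a (m + t)" using comm[OF ab(1)] by simp
    also have "f a (m + t) = special_point (k + nat q)"
      using fa[of "k + nat q"] unfolding t_eq by (simp only: add.commute[of m])
    also have "\<dots> = a t" using special(1)[of "k + nat q"] unfolding t_eq by (rule sym)
    also have "\<dots> = y 0" using win[of 0] q[of 0] by simp
    finally show ?thesis .
  qed
  \<comment> \<open>Translating \<open>y\<close> by \<open>i - m\<close> turns index
    \<open>m\<close> into \<open>i\<close> and index 0 into \<open>i - m\<close>.\<close>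
  have "f y i = y (i + (- m))" if y: "y \<in> Y" for y i
    using at_m[OF translate_in_Y[OF y, of "i - m"]] comm[OF y, of "i - m"] by simp
  then show ?thesis by blast
qed

section \<open>Powers of the shift and the quotient group\<close>

lemma shift_pow_apply:
  assumes y: "y \<in> Y"
  shows "(restrict shift Y [^]\<^bsub>Aut_shift A Y\<^esub> (n::int)) y = (\<lambda>i. y (i + n))"
proof -
  let ?G = "Aut_shift A Y" and ?s = "restrict shift Y"
  interpret G: group ?G by (rule group_Aut_shift[OF finite_A subshift_Y])
  have s: "?s \<in> carrier ?G"
    by (rule shift_in_Aut_shift[OF finite_A subshift_Y shift_image_two_sided_version])
  have mult: "(g \<otimes>\<^bsub>?G\<^esub> h) y = g (h y)" if "g \<in> carrier ?G" "h \<in> carrier ?G" "y \<in> Y" for g h y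
    using that by (simp add: Aut_shift_def BijGroup_def compose_def)
  have one: "\<one>\<^bsub>?G\<^esub> y = y" if "y \<in> Y" for y
    using that by (simp add: Aut_shift_def BijGroup_def)
  \<comment> \<open>In a successor power the last factor acts first, so the induction hypothesis is
    used at \<open>shift y\<close> and \<open>y\<close> must be arbitrary.\<close>
  have nat: "(?s [^]\<^bsub>?G\<^esub> k) y = (\<lambda>i. y (i + int k))" if y: "y \<in> Y" for k :: nat and y
    using y
  proof (induction k arbitrary: y)
    case (Suc k)
    have "shift y \<in> Y" using translate_in_Y[OF Suc.prems, of 1] by (simp add: shift_def)
    then have "(?s [^]\<^bsub>?G\<^esub> Suc k) y = (\<lambda>i. shift y (i + int k))"
      using Suc.IH[OF \<open>shift y \<in> Y\<close>] Suc.prems s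
      by (simp only: nat_pow_Suc mult G.nat_pow_closed restrict_apply')
    also have "\<dots> = (\<lambda>i. y (i + int (Suc k)))" by (simp add: shift_def algebra_simps)
    finally show ?case .
  qed (simp add: one)
  show ?thesis
  proof (cases "n \<ge> 0")
    case True
    then have "?s [^]\<^bsub>?G\<^esub> n = ?s [^]\<^bsub>?G\<^esub> nat n" by (simp add: pow_nat)
    then show ?thesis using nat[OF y, of "nat n"] True by (simp del: pow_nat)
  next
    case False
    define p where "p = ?s [^]\<^bsub>?G\<^esub> nat (- n)"
    have p: "p \<in> carrier ?G" using s by (simp add: p_def)
    have "?s [^]\<^bsub>?G\<^esub> n = inv\<^bsub>?G\<^esub> p"
      using False int_pow_def2[of ?G ?s n] by (simp add: p_def)
    moreover have "(inv\<^bsub>?G\<^esub> p) y = (\<lambda>i. y (i + n))"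
    proof -
      \<comment> \<open>For negative \<open>n\<close>, the claimed value is identified as the point
        that the positive power \<open>p\<close> maps to \<open>y\<close>.\<close>
      have "y = p (\<lambda>i. y (i + n))"
        using nat[OF translate_in_Y[OF y], of "nat (- n)" n] False by (simp add: p_def)
      then show ?thesis
        using mult[OF G.inv_closed[OF p] p translate_in_Y[OF y, of n]] p
          one[OF translate_in_Y[OF y, of n]] by simp
    qed
    ultimately show ?thesis by simp
  qed
qed

text \<open>Every automorphism agrees on \<open>Y\<close> with a translation, hence with a power of
  the shift; both are extensional, so they are equal.\<close>

lemma shift_powers_eq_carrier: "shift_powers A Y = carrier (Aut_shift A Y)"
proof
  let ?G = "Aut_shift A Y" and ?s = "restrict shift Y"
  interpret G: group ?G by (rule group_Aut_shift[OF finite_A subshift_Y])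
  have s: "?s \<in> carrier ?G"
    by (rule shift_in_Aut_shift[OF finite_A subshift_Y shift_image_two_sided_version])
  show "shift_powers A Y \<subseteq> carrier ?G"
    using s by (auto simp: shift_powers_def)
  show "carrier ?G \<subseteq> shift_powers A Y"
  proof
    fix f assume f: "f \<in> carrier ?G"
    then obtain n where n: "\<forall>y\<in>Y. f y = (\<lambda>i. y (i + n))"
      using automorphism_is_translation[of f] by (auto simp: Aut_shift_def Bij_def)
    have ext: "g \<in> extensional Y" if "g \<in> carrier ?G" for g
      using that by (auto simp: Aut_shift_def Bij_def)
    have "f = ?s [^]\<^bsub>?G\<^esub> n"
      using n shift_pow_apply[of _ n] s by (intro extensionalityI[OF ext[OF f] ext]) auto
    then show "f \<in> shift_powers A Y" by (auto simp: shift_powers_def)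
  qed
qed

end

text \<open>Every coset of the whole group is the whole group.\<close>

lemma (in group) trivial_group_Mod_carrier: "trivial_group (G Mod carrier G)"
proof -
  have "carrier (G Mod carrier G) = {carrier G}"
    using coset_join2[OF _ subgroup_self] by (auto simp: FactGroup_def RCOSETS_def)
  then show ?thesis
    using normal.factorgroup_is_group[OF normal_self] by (simp add: trivial_group_def)
qed

theorem corollary4p1:
  fixes A :: "'a set" and X :: "(nat \<Rightarrow> 'a) set"
  assumes "finite A" and "sturmian_one_sided A X"
  shows "trivial_group (Aut_shift A X) \<and>
    trivial_group (Aut_shift A (two_sided_version X) Mod shift_powers A (two_sided_version X))"
proof -
  interpret sturmian A X using assms by unfold_locales
  interpret G: group "Aut_shift A Y" by (rule group_Aut_shift[OF finite_A subshift_Y])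
  show ?thesis
    using trivial_Aut_one_sided G.trivial_group_Mod_carrier by (simp add: shift_powers_eq_carrier)
qed

end
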